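(* Let $(R,r)$ be the $T_0$ reflector on $\mathbf{Top}$. For each topological space $X=(X,\tau)$, there is a homeomorphism $\varphi:R\mathfrak{U}X\to\Sigma X$ with $\varphi\cdot r_{\mathfrak{U}X}=\alpha_X$, where $\alpha_X:\mathfrak{U}X\to\Sigma X$ is the map $\mathcal{F}\mapsto\mathcal{F}\cap\tau$.
   Context: $\mathbf{Top}$ is the category of topological spaces and continuous maps. The $T_0$ reflector $(R,r)$ is the left adjoint $R$ (viewed as an endofunctor of $\mathbf{Top}$) of the inclusion of the full subcategory of $T_0$ spaces, with unit $r:1\to R$; $r_X:X\to RX$ is the $T_0$ quotient map. For a space $X$, $\mathfrak{U}X$ is the set of ultrafilters on the set $X$, with the topology having as basis the sets $O^*=\{\mathcal{F}\in\mathfrak{U}X\mid O\in\mathcal{F}\}$, $O\subseteq X$ open. For a space $(X,\tau)$, $\Sigma X$ is the set of prime open filters on $X$, i.e. proper filters $\mathcal{G}$ in the lattice $\tau$ such that for open $O,U$ with $O\cup U\in\mathcal{G}$, $O\in\mathcal{G}$ or $U\in\mathcal{G}$. Its topology has as basis the sets $O^{\times}=\{\mathcal{G}\in\Sigma X\mid O\in\mathcal{G}\}$, $O\subseteq X$ open. *)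

theory Defs
  imports "HOL-Analysis.Analysis"
begin

section \<open>Filters in a lattice of sets\<close>

definition proper_filter :: "'a set set \<Rightarrow> 'a set set \<Rightarrow> bool" where
  "proper_filter L G \<longleftrightarrow>
     G \<subseteq> L \<and> G \<noteq> {} \<and> (\<forall>A\<in>G. \<forall>B\<in>G. A \<inter> B \<in> G) \<and>
     (\<forall>A\<in>G. \<forall>B\<in>L. A \<subseteq> B \<longrightarrow> B \<in> G) \<and> G \<noteq> L"

definition ultrafilter_on :: "'a set \<Rightarrow> 'a set set \<Rightarrow> bool" where
  "ultrafilter_on S F \<longleftrightarrow>
     proper_filter (Pow S) F \<and> (\<forall>G. proper_filter (Pow S) G \<and> F \<subseteq> G \<longrightarrow> G = F)"

definition prime_open_filter :: "'a topology \<Rightarrow> 'a set set \<Rightarrow> bool" where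
  "prime_open_filter X G \<longleftrightarrow>
     proper_filter {U. openin X U} G \<and>
     (\<forall>V U. openin X V \<and> openin X U \<and> V \<union> U \<in> G \<longrightarrow> V \<in> G \<or> U \<in> G)"

lemma proper_filterI:
  assumes "G \<subseteq> L" "S \<in> G" "\<And>A B. A \<in> G \<Longrightarrow> B \<in> G \<Longrightarrow> A \<inter> B \<in> G"
    "\<And>A B. A \<in> G \<Longrightarrow> B \<in> L \<Longrightarrow> A \<subseteq> B \<Longrightarrow> B \<in> G" "E \<in> L" "E \<notin> G"
  shows "proper_filter L G"
  unfolding proper_filter_def
proof (intro conjI ballI impI)
  show "G \<noteq> {}" using assms(2) by blast
  show "G \<noteq> L" using assms(5,6) by blast
qed (use assms(1,3,4) in auto)

lemma proper_filterD:
  assumes "proper_filter L G"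
  shows "G \<subseteq> L" "\<And>A B. A \<in> G \<Longrightarrow> B \<in> G \<Longrightarrow> A \<inter> B \<in> G"
    "\<And>A B. A \<in> G \<Longrightarrow> B \<in> L \<Longrightarrow> A \<subseteq> B \<Longrightarrow> B \<in> G"
  using assms unfolding proper_filter_def by auto

lemma proper_filter_Int_iff:
  assumes "proper_filter L G" "A \<in> L" "B \<in> L"
  shows "A \<in> G \<and> B \<in> G \<longleftrightarrow> A \<inter> B \<in> G"
proof
  assume "A \<inter> B \<in> G"
  then show "A \<in> G \<and> B \<in> G"
    using proper_filterD(3) [OF assms(1), of "A \<inter> B"] assms(2,3) by simp
qed (simp add: proper_filterD(2) [OF assms(1)])

lemma proper_filter_empty:
  assumes "{} \<in> L" "proper_filter L G"
  shows "{} \<notin> G"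
  using assms unfolding proper_filter_def by blast

lemma proper_filter_top:
  assumes "proper_filter L G" "S \<in> L" "\<Union>L \<subseteq> S"
  shows "S \<in> G"
  using assms unfolding proper_filter_def by blast

lemma ultrafilter_on_iff:
  "ultrafilter_on S F \<longleftrightarrow>
     proper_filter (Pow S) F \<and> (\<forall>A\<subseteq>S. A \<in> F \<or> S - A \<in> F)"
  (is "_ \<longleftrightarrow> ?rhs")
proof
  assume F: "ultrafilter_on S F"
  then have pf: "proper_filter (Pow S) F"
    and mx: "\<And>G. proper_filter (Pow S) G \<Longrightarrow> F \<subseteq> G \<Longrightarrow> G = F"
    by (auto simp: ultrafilter_on_def)
  have sub: "F \<subseteq> Pow S" and int: "\<And>A B. A \<in> F \<Longrightarrow> B \<in> F \<Longrightarrow> A \<inter> B \<in> F"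
    and up: "\<And>A B. A \<in> F \<Longrightarrow> B \<subseteq> S \<Longrightarrow> A \<subseteq> B \<Longrightarrow> B \<in> F"
    using pf unfolding proper_filter_def by auto
  have SF: "S \<in> F" by (rule proper_filter_top [OF pf]) auto
  have "A \<in> F" if A: "A \<subseteq> S" "S - A \<notin> F" for A
  proof -
    define G where "G = {B. B \<subseteq> S \<and> (\<exists>C\<in>F. A \<inter> C \<subseteq> B)}"
    have FG: "F \<subseteq> G" using sub unfolding G_def by blast
    have AG: "A \<in> G" using A SF unfolding G_def by blast
    have "{} \<notin> G"
    proof
      assume "{} \<in> G"
      then obtain C where "C \<in> F" "A \<inter> C \<subseteq> {}" unfolding G_def by blast
      then have "S - A \<in> F" using up [of C "S - A"] sub by blast
      with A show False by blast
    qed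
    moreover have "B \<inter> D \<in> G" if BD: "B \<in> G" "D \<in> G" for B D
    proof -
      obtain C1 where C1: "C1 \<in> F" "A \<inter> C1 \<subseteq> B" "B \<subseteq> S"
        using BD(1) unfolding G_def by auto
      obtain C2 where C2: "C2 \<in> F" "A \<inter> C2 \<subseteq> D"
        using BD(2) unfolding G_def by auto
      have "C1 \<inter> C2 \<in> F" "A \<inter> (C1 \<inter> C2) \<subseteq> B \<inter> D" "B \<inter> D \<subseteq> S"
        using int C1 C2 by auto
      then show ?thesis unfolding G_def by auto
    qed
    moreover have "D \<in> G" if BD: "B \<in> G" "D \<subseteq> S" "B \<subseteq> D" for B D
    proof -
      obtain C where "C \<in> F" "A \<inter> C \<subseteq> B" using BD(1) unfolding G_def by auto
      moreover from this BD(3) have "A \<inter> C \<subseteq> D" by blast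
      ultimately show ?thesis using BD(2) unfolding G_def by auto
    qed
    moreover have "G \<subseteq> Pow S" unfolding G_def by auto
    ultimately have "proper_filter (Pow S) G"
      using AG by (intro proper_filterI [of G "Pow S" A "{}"]) auto
    from mx [OF this FG] AG show ?thesis by simp
  qed
  with pf show ?rhs by blast
next
  assume R: ?rhs
  have "G \<subseteq> F" if G: "proper_filter (Pow S) G" "F \<subseteq> G" for G
  proof
    fix A assume A: "A \<in> G"
    then have AS: "A \<subseteq> S" using G unfolding proper_filter_def by blast
    have "S - A \<notin> F"
    proof
      assume "S - A \<in> F"
      then have "A \<inter> (S - A) \<in> G" using A G unfolding proper_filter_def by blast
      then show False using proper_filter_empty [OF _ G(1)] by simp
    qed
    with R AS show "A \<in> F" by blast
  qed
  with R show "ultrafilter_on S F" unfolding ultrafilter_on_def by blast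
qed

section \<open>The space of ultrafilters and the space of prime open filters\<close>

definition ultrafilter_space :: "'a topology \<Rightarrow> 'a set set topology" where
  "ultrafilter_space X =
     topology (arbitrary union_of
       (\<lambda>B. \<exists>V. openin X V \<and> B = {F. ultrafilter_on (topspace X) F \<and> V \<in> F}))"

definition prime_open_filter_space :: "'a topology \<Rightarrow> 'a set set topology" where
  "prime_open_filter_space X =
     topology (arbitrary union_of
       (\<lambda>B. \<exists>V. openin X V \<and> B = {G. prime_open_filter X G \<and> V \<in> G}))"

definition open_trace :: "'a topology \<Rightarrow> 'a set set \<Rightarrow> 'a set set" where
  "open_trace X F = F \<inter> {U. openin X U}"

lemma openin_ultrafilter_space:
  "openin (ultrafilter_space X) =
     arbitrary union_of
       (\<lambda>B. \<exists>V. openin X V \<and> B = {F. ultrafilter_on (topspace X) F \<and> V \<in> F})"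
  unfolding ultrafilter_space_def
proof (rule topology_inverse', rule istopology_base)
  fix A B
  assume "\<exists>V. openin X V \<and> A = {F. ultrafilter_on (topspace X) F \<and> V \<in> F}"
    and "\<exists>V. openin X V \<and> B = {F. ultrafilter_on (topspace X) F \<and> V \<in> F}"
  then obtain V W where V: "openin X V" "A = {F. ultrafilter_on (topspace X) F \<and> V \<in> F}"
    and W: "openin X W" "B = {F. ultrafilter_on (topspace X) F \<and> W \<in> F}" by auto
  have "V \<in> F \<and> W \<in> F \<longleftrightarrow> V \<inter> W \<in> F" if "ultrafilter_on (topspace X) F" for F
    using that openin_subset [OF V(1)] openin_subset [OF W(1)]
    unfolding ultrafilter_on_def by (intro proper_filter_Int_iff) auto
  then have "A \<inter> B = {F. ultrafilter_on (topspace X) F \<and> V \<inter> W \<in> F}"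
    unfolding V(2) W(2) by auto
  then show "\<exists>V. openin X V \<and> A \<inter> B = {F. ultrafilter_on (topspace X) F \<and> V \<in> F}"
    using openin_Int [OF V(1) W(1)] by auto
qed

lemma openin_prime_open_filter_space:
  "openin (prime_open_filter_space X) =
     arbitrary union_of
       (\<lambda>B. \<exists>V. openin X V \<and> B = {G. prime_open_filter X G \<and> V \<in> G})"
  unfolding prime_open_filter_space_def
proof (rule topology_inverse', rule istopology_base)
  fix A B
  assume "\<exists>V. openin X V \<and> A = {G. prime_open_filter X G \<and> V \<in> G}"
    and "\<exists>V. openin X V \<and> B = {G. prime_open_filter X G \<and> V \<in> G}"
  then obtain V W where V: "openin X V" "A = {G. prime_open_filter X G \<and> V \<in> G}"
    and W: "openin X W" "B = {G. prime_open_filter X G \<and> W \<in> G}" by auto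
  have "V \<in> G \<and> W \<in> G \<longleftrightarrow> V \<inter> W \<in> G" if "prime_open_filter X G" for G
    using that V(1) W(1) unfolding prime_open_filter_def
    by (intro proper_filter_Int_iff) auto
  then have "A \<inter> B = {G. prime_open_filter X G \<and> V \<inter> W \<in> G}"
    unfolding V(2) W(2) by auto
  then show "\<exists>V. openin X V \<and> A \<inter> B = {G. prime_open_filter X G \<and> V \<in> G}"
    using openin_Int [OF V(1) W(1)] by auto
qed

lemma topspace_ultrafilter_space:
  "topspace (ultrafilter_space X) = {F. ultrafilter_on (topspace X) F}"
proof
  show "topspace (ultrafilter_space X) \<subseteq> {F. ultrafilter_on (topspace X) F}"
    unfolding topspace_def openin_ultrafilter_space
    by (auto simp: union_of_def arbitrary_def)
  have eq: "{F. ultrafilter_on (topspace X) F}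
      = {F. ultrafilter_on (topspace X) F \<and> topspace X \<in> F}"
    using proper_filter_top [of "Pow (topspace X)" _ "topspace X"]
    by (auto simp: ultrafilter_on_def)
  have "openin (ultrafilter_space X) {F. ultrafilter_on (topspace X) F}"
    unfolding openin_ultrafilter_space
    by (rule union_of_inc) (use eq in \<open>auto simp: arbitrary_def\<close>)
  then show "{F. ultrafilter_on (topspace X) F} \<subseteq> topspace (ultrafilter_space X)"
    by (rule openin_subset)
qed

lemma topspace_prime_open_filter_space:
  "topspace (prime_open_filter_space X) = {G. prime_open_filter X G}"
proof
  show "topspace (prime_open_filter_space X) \<subseteq> {G. prime_open_filter X G}"
    unfolding topspace_def openin_prime_open_filter_space
    by (auto simp: union_of_def arbitrary_def)
  have eq: "{G. prime_open_filter X G} = {G. prime_open_filter X G \<and> topspace X \<in> G}"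
    using proper_filter_top [of "{U. openin X U}" _ "topspace X"]
    by (auto simp: prime_open_filter_def dest: openin_subset)
  have "openin (prime_open_filter_space X) {G. prime_open_filter X G}"
    unfolding openin_prime_open_filter_space
    by (rule union_of_inc) (use eq in \<open>auto simp: arbitrary_def\<close>)
  then show "{G. prime_open_filter X G} \<subseteq> topspace (prime_open_filter_space X)"
    by (rule openin_subset)
qed

section \<open>The $T_0$ reflector\<close>

text \<open>
  The category of topological spaces is rendered as the spaces whose points lie in a type
  \<open>'u\<close>, with continuous maps identified when they agree on the underlying set. A left
  adjoint of the inclusion of the $T_0$ spaces, with unit \<open>r\<close>, is a family of universal
  arrows \<open>r X : X \<rightarrow> R X\<close>; this determines the action of \<open>R\<close> on maps. Extensionality
  selects one representative function of each map, so that uniqueness can be expressed.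
\<close>

definition T0_reflector ::
    "('u topology \<Rightarrow> 'u topology) \<Rightarrow> ('u topology \<Rightarrow> 'u \<Rightarrow> 'u) \<Rightarrow> bool" where
  "T0_reflector R r \<longleftrightarrow>
     (\<forall>X. t0_space (R X) \<and> continuous_map X (R X) (r X) \<and>
       (\<forall>(Y :: 'u topology) f. t0_space Y \<and> continuous_map X Y f \<longrightarrow>
         (\<exists>!g. g \<in> extensional (topspace (R X)) \<and> continuous_map (R X) Y g \<and>
              (\<forall>x\<in>topspace X. g (r X x) = f x))))"

text \<open>
  The Kolmogorov quotient is such a reflector; its universal property holds for target
  spaces \<open>Y\<close> over any type.
\<close>

lemma t0_space_Kolmogorov_quotient_image:
  "t0_space (subtopology X (Kolmogorov_quotient X ` topspace X))"
  unfolding t0_space_def openin_subtopology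
proof (intro ballI impI)
  fix x y
  assume "x \<in> topspace (subtopology X (Kolmogorov_quotient X ` topspace X))"
    "y \<in> topspace (subtopology X (Kolmogorov_quotient X ` topspace X))" "x \<noteq> y"
  then obtain a b where ab: "x = Kolmogorov_quotient X a" "y = Kolmogorov_quotient X b"
      "a \<in> topspace X" "b \<in> topspace X" "x \<noteq> y"
    by auto
  then obtain U where U: "openin X U" "(a \<in> U) \<noteq> (b \<in> U)"
    using Kolmogorov_quotient_eq [of X a b] by auto
  show "\<exists>U. (\<exists>T. openin X T \<and> U = T \<inter> Kolmogorov_quotient X ` topspace X) \<and> (x \<notin> U) = (y \<in> U)"
    by (rule exI [of _ "U \<inter> Kolmogorov_quotient X ` topspace X"])
       (use U ab in \<open>auto simp: Kolmogorov_quotient_in_open\<close>)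
qed

lemma Kolmogorov_quotient_universal:
  fixes X :: "'a topology" and Y :: "'b topology"
  assumes Y: "t0_space Y" and f: "continuous_map X Y f"
  defines "K \<equiv> subtopology X (Kolmogorov_quotient X ` topspace X)"
  shows "\<exists>!g. g \<in> extensional (topspace K) \<and> continuous_map K Y g \<and>
              (\<forall>x\<in>topspace X. g (Kolmogorov_quotient X x) = f x)"
proof -
  have tK: "topspace K = Kolmogorov_quotient X ` topspace X"
    unfolding K_def by (auto simp: Kolmogorov_quotient_in_topspace)
  obtain g where g: "continuous_map K Y g"
      "\<And>x. x \<in> topspace X \<Longrightarrow> g (Kolmogorov_quotient X x) = f x"
    using Kolmogorov_quotient_lift_exists [of "topspace X" X Y f] Y f
    unfolding K_def by auto
  show ?thesis
  proof (rule ex1I [of _ "restrict g (topspace K)"], intro conjI ballI)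
    show "continuous_map K Y (restrict g (topspace K))"
      using g(1) by (rule continuous_map_eq) simp
    fix x assume "x \<in> topspace X"
    then show "restrict g (topspace K) (Kolmogorov_quotient X x) = f x"
      using g tK by simp
  next
    fix h
    assume h: "h \<in> extensional (topspace K) \<and> continuous_map K Y h \<and>
              (\<forall>x\<in>topspace X. h (Kolmogorov_quotient X x) = f x)"
    show "h = restrict g (topspace K)"
    proof (rule extensionalityI [of _ "topspace K"])
      fix y assume "y \<in> topspace K"
      then show "h y = restrict g (topspace K) y" using h g tK by auto
    qed (use h in auto)
  qed auto
qed

lemma T0_reflector_Kolmogorov_quotient:
  "T0_reflector (\<lambda>X :: 'u topology. subtopology X (Kolmogorov_quotient X ` topspace X))
     Kolmogorov_quotient"
  unfolding T0_reflector_def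
proof (intro allI impI conjI)
  fix X :: "'u topology"
  show "t0_space (subtopology X (Kolmogorov_quotient X ` topspace X))"
    by (rule t0_space_Kolmogorov_quotient_image)
  show "continuous_map X (subtopology X (Kolmogorov_quotient X ` topspace X)) (Kolmogorov_quotient X)"
    by (rule quotient_imp_continuous_map [OF quotient_map_Kolmogorov_quotient])
next
  fix X Y :: "'u topology" and f
  assume "t0_space Y \<and> continuous_map X Y f"
  then show "\<exists>!g. g \<in> extensional (topspace (subtopology X (Kolmogorov_quotient X ` topspace X))) \<and>
      continuous_map (subtopology X (Kolmogorov_quotient X ` topspace X)) Y g \<and>
      (\<forall>x\<in>topspace X. g (Kolmogorov_quotient X x) = f x)"
    by (intro Kolmogorov_quotient_universal) auto
qed

end

theory Submission
  imports Defs
begin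

text \<open>
  The map \<open>\<alpha>\<close> that sends an ultrafilter to its open members has three properties. Its target
  is \<open>T\<^sub>0\<close>, because two distinct prime open filters differ in some open set \<open>V\<close>, and
  hence are separated by the basic open set of \<open>V\<close>. The topology of its source is the one
  induced by \<open>\<alpha>\<close>, because the basic open set of \<open>V\<close> in the source is the preimage of
  the basic open set of \<open>V\<close> in the target. And it is surjective, the step that needs
  Zorn's lemma: for a prime open filter \<open>G\<close> the differences \<open>V - U\<close> with
  \<open>V\<close> in \<open>G\<close> and \<open>U\<close> open outside \<open>G\<close> form a filter base, and an ultrafilter
  containing them has exactly the members of \<open>G\<close> as its open members
  (\<open>prime_open_filter_is_open_trace\<close>).

  A surjection onto a \<open>T\<^sub>0\<close> space that induces the topology of its source is a model of the
  \<open>T\<^sub>0\<close> reflection, by the universal property alone (\<open>T0_reflector_homeomorphic_map\<close>).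
\<close>

section \<open>Recognising the \<open>T\<^sub>0\<close> reflection\<close>

lemma continuous_map_to_t0_cong:
  assumes Y: "t0_space Y" and f: "continuous_map X Y f"
    and xy: "x \<in> topspace X" "y \<in> topspace X"
    and indist: "\<And>U. openin X U \<Longrightarrow> x \<in> U \<longleftrightarrow> y \<in> U"
  shows "f x = f y"
proof (rule ccontr)
  assume ne: "f x \<noteq> f y"
  have "f x \<in> topspace Y" "f y \<in> topspace Y"
    using f xy by (auto simp: continuous_map_def)
  with Y ne obtain U where U: "openin Y U" "f x \<notin> U \<longleftrightarrow> f y \<in> U"
    unfolding t0_space_def by blast
  then show False
    using indist [OF openin_continuous_map_preimage [OF f U(1)]] xy by auto
qed

text \<open>
  Points with the same image under \<open>q\<close> lie in the same open sets, so the unit \<open>r Y\<close> is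
  constant on the fibres of \<open>q\<close> and descends along the quotient map \<open>q\<close>; conversely
  \<open>q\<close> factors through \<open>r Y\<close>. The two factorisations are mutually inverse: on \<open>Z\<close>
  because \<open>q\<close> is surjective, on \<open>R Y\<close> by the uniqueness clause of the universal property.
\<close>

lemma T0_reflector_homeomorphic_map:
  fixes Y Z :: "'u topology"
  assumes R: "T0_reflector R r" and Z: "t0_space Z"
    and q: "continuous_map Y Z q" and surj: "q ` topspace Y = topspace Z"
    and ind: "\<And>U. openin Y U \<Longrightarrow> \<exists>W. openin Z W \<and> U = {y \<in> topspace Y. q y \<in> W}"
  shows "\<exists>\<phi>. homeomorphic_map (R Y) Z \<phi> \<and> (\<forall>y\<in>topspace Y. \<phi> (r Y y) = q y)"
proof -
  have RT: "t0_space (R Y)" and rc: "continuous_map Y (R Y) (r Y)"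
    and univ: "\<And>(W :: 'u topology) f. t0_space W \<Longrightarrow> continuous_map Y W f \<Longrightarrow>
         \<exists>!g. g \<in> extensional (topspace (R Y)) \<and> continuous_map (R Y) W g \<and>
              (\<forall>x\<in>topspace Y. g (r Y x) = f x)"
    using R unfolding T0_reflector_def by blast+
  obtain g where g: "continuous_map (R Y) Z g" "\<And>x. x \<in> topspace Y \<Longrightarrow> g (r Y x) = q x"
    using univ [OF Z q] by blast
  have "open_map Y Z q"
    unfolding open_map_def
  proof (intro allI impI)
    fix U assume "openin Y U"
    then obtain W where W: "openin Z W" "U = {y \<in> topspace Y. q y \<in> W}"
      using ind by blast
    then have "q ` U = W" using openin_subset [OF W(1)] surj by auto
    with W show "openin Z (q ` U)" by simp
  qed
  then have quot: "quotient_map Y Z q"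
    using q surj by (simp add: continuous_open_imp_quotient_map)
  have fib: "r Y x = r Y y" if "x \<in> topspace Y" "y \<in> topspace Y" "q x = q y" for x y
  proof (rule continuous_map_to_t0_cong [OF RT rc that(1,2)])
    fix U assume "openin Y U"
    then show "x \<in> U \<longleftrightarrow> y \<in> U" using ind that by fastforce
  qed
  obtain h where h: "continuous_map Z (R Y) h" "\<And>x. x \<in> topspace Y \<Longrightarrow> h (q x) = r Y x"
    using quotient_map_lift_exists [OF quot rc] fib by metis
  have gh: "g (h z) = z" if z: "z \<in> topspace Z" for z
  proof -
    obtain y where "y \<in> topspace Y" "z = q y" using z surj by blast
    then show ?thesis using g h by simp
  qed
  have hg: "h (g w) = w" if w: "w \<in> topspace (R Y)" for w
  proof -
    let ?T = "topspace (R Y)"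
    have "continuous_map (R Y) (R Y) (restrict (h \<circ> g) ?T)"
      by (rule continuous_map_eq [OF continuous_map_compose [OF g(1) h(1)]]) simp
    moreover have "continuous_map (R Y) (R Y) (restrict id ?T)"
      by (rule continuous_map_eq [OF continuous_map_id]) simp
    moreover have "r Y x \<in> ?T" if "x \<in> topspace Y" for x
      using rc that by (auto simp: continuous_map_def)
    moreover have "k = k'"
      if "k \<in> extensional ?T" "continuous_map (R Y) (R Y) k" "\<forall>x\<in>topspace Y. k (r Y x) = r Y x"
        and "k' \<in> extensional ?T" "continuous_map (R Y) (R Y) k'" "\<forall>x\<in>topspace Y. k' (r Y x) = r Y x"
      for k k'
      using univ [OF RT rc] that by blast
    ultimately have eq: "restrict (h \<circ> g) ?T = restrict id ?T"
      using g(2) h(2) by simp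
    show ?thesis using fun_cong [OF eq, of w] w by simp
  qed
  have "homeomorphic_maps (R Y) Z g h"
    unfolding homeomorphic_maps_def using g h gh hg by blast
  then show ?thesis using g(2) homeomorphic_map_maps by blast
qed

section \<open>Prime open filters are traces of ultrafilters\<close>

lemma ultrafilter_extension:
  assumes F: "proper_filter (Pow S) F"
  shows "\<exists>M. ultrafilter_on S M \<and> F \<subseteq> M"
proof -
  define \<A> where "\<A> = {G. proper_filter (Pow S) G \<and> F \<subseteq> G}"
  have ub: "\<Union>\<C> \<in> \<A>" if ne: "\<C> \<noteq> {}" and ch: "subset.chain \<A> \<C>" for \<C>
  proof -
    have pf: "\<And>G. G \<in> \<C> \<Longrightarrow> proper_filter (Pow S) G" and sub: "\<And>G. G \<in> \<C> \<Longrightarrow> F \<subseteq> G"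
      and tot: "\<And>G H. G \<in> \<C> \<Longrightarrow> H \<in> \<C> \<Longrightarrow> G \<subseteq> H \<or> H \<subseteq> G"
      using ch unfolding subset_chain_def \<A>_def by blast+
    have FC: "F \<subseteq> \<Union>\<C>" using ne sub by blast
    have "proper_filter (Pow S) (\<Union>\<C>)"
    proof (rule proper_filterI)
      show "\<Union>\<C> \<subseteq> Pow S" using pf proper_filterD(1) by blast
      show "S \<in> \<Union>\<C>" using FC proper_filter_top [OF F, of S] by auto
      show "{} \<in> Pow S" "{} \<notin> \<Union>\<C>"
        using pf proper_filter_empty [of "Pow S"] by auto
      show "A \<inter> B \<in> \<Union>\<C>" if AB: "A \<in> \<Union>\<C>" "B \<in> \<Union>\<C>" for A B
      proof -
        obtain G where "G \<in> \<C>" "A \<in> G" "B \<in> G" using AB tot by blast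
        then show ?thesis using pf proper_filterD(2) by blast
      qed
      show "B \<in> \<Union>\<C>" if "A \<in> \<Union>\<C>" "B \<in> Pow S" "A \<subseteq> B" for A B
        using that pf proper_filterD(3) by blast
    qed
    with FC show ?thesis by (simp add: \<A>_def)
  qed
  have "\<A> \<noteq> {}" using F by (auto simp: \<A>_def)
  then obtain M where "M \<in> \<A>" "\<forall>G\<in>\<A>. M \<subseteq> G \<longrightarrow> G = M"
    using subset_Zorn_nonempty [of \<A>] ub by blast
  then show ?thesis unfolding ultrafilter_on_def \<A>_def by blast
qed

lemma prime_open_filter_open_trace:
  assumes "ultrafilter_on (topspace X) F"
  shows "prime_open_filter X (open_trace X F)"
proof -
  have pf: "proper_filter (Pow (topspace X)) F"
    and ult: "\<And>A. A \<subseteq> topspace X \<Longrightarrow> A \<in> F \<or> topspace X - A \<in> F"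
    using assms by (auto simp: ultrafilter_on_iff)
  note filt = proper_filterD [OF pf]
  have empty: "{} \<notin> F" using proper_filter_empty [OF _ pf] by simp
  have top: "topspace X \<in> F" by (rule proper_filter_top [OF pf]) auto
  have "proper_filter {U. openin X U} (open_trace X F)"
  proof (rule proper_filterI)
    show "topspace X \<in> open_trace X F" using top by (simp add: open_trace_def)
    show "{} \<in> {U. openin X U}" "{} \<notin> open_trace X F"
      using empty by (auto simp: open_trace_def)
    show "A \<inter> B \<in> open_trace X F" if "A \<in> open_trace X F" "B \<in> open_trace X F" for A B
      using that filt(2) by (auto simp: open_trace_def)
    show "B \<in> open_trace X F" if "A \<in> open_trace X F" "B \<in> {U. openin X U}" "A \<subseteq> B" for A B
      using that filt(3) [of A B] openin_subset by (auto simp: open_trace_def)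
  qed (auto simp: open_trace_def)
  moreover have "V \<in> open_trace X F \<or> U \<in> open_trace X F"
    if VU: "openin X V" "openin X U" "V \<union> U \<in> open_trace X F" for V U
  proof (rule ccontr)
    assume "\<not> ?thesis"
    then have "topspace X - V \<in> F" "topspace X - U \<in> F"
      using VU ult openin_subset by (auto simp: open_trace_def)
    then have "(V \<union> U) \<inter> ((topspace X - V) \<inter> (topspace X - U)) \<in> F"
      using VU(3) filt(2) by (auto simp: open_trace_def)
    moreover have "(V \<union> U) \<inter> ((topspace X - V) \<inter> (topspace X - U)) = {}" by blast
    ultimately show False using empty by simp
  qed
  ultimately show ?thesis unfolding prime_open_filter_def by blast
qed

text \<open>
  The members of \<open>G\<close> have to be put into the ultrafilter and the open sets outside \<open>G\<close>
  have to be kept out, that is, their complements put in. Primality makes the open sets outside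
  \<open>G\<close> closed under binary unions, so the sets \<open>V - U\<close> are closed under intersections; none
  is empty, because \<open>V \<subseteq> U\<close> would force \<open>U\<close> into \<open>G\<close>.
\<close>

lemma prime_open_filter_is_open_trace:
  assumes G: "prime_open_filter X G"
  shows "\<exists>F. ultrafilter_on (topspace X) F \<and> open_trace X F = G"
proof -
  let ?S = "topspace X"
  have pf: "proper_filter {U. openin X U} G"
    and prime: "\<And>V U. openin X V \<Longrightarrow> openin X U \<Longrightarrow> V \<union> U \<in> G \<Longrightarrow> V \<in> G \<or> U \<in> G"
    using G by (auto simp: prime_open_filter_def)
  have op: "\<And>V. V \<in> G \<Longrightarrow> openin X V" and int: "\<And>V W. V \<in> G \<Longrightarrow> W \<in> G \<Longrightarrow> V \<inter> W \<in> G"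
    and up: "\<And>V U. V \<in> G \<Longrightarrow> openin X U \<Longrightarrow> V \<subseteq> U \<Longrightarrow> U \<in> G"
    using proper_filterD [OF pf] by auto
  have empty: "{} \<notin> G" using proper_filter_empty [OF _ pf] by simp
  have top: "?S \<in> G" by (rule proper_filter_top [OF pf]) (auto dest: openin_subset)
  define B where "B = {A. A \<subseteq> ?S \<and> (\<exists>V U. V \<in> G \<and> openin X U \<and> U \<notin> G \<and> V - U \<subseteq> A)}"
  have BI: "A \<in> B" if "V \<in> G" "openin X U" "U \<notin> G" "V - U \<subseteq> A" "A \<subseteq> ?S" for A V U
    using that unfolding B_def by blast
  have "proper_filter (Pow ?S) B"
  proof (rule proper_filterI)
    show "B \<subseteq> Pow ?S" by (auto simp: B_def)
    show "?S \<in> B" by (rule BI [OF top openin_empty empty]) auto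
    show "{} \<in> Pow ?S" "{} \<notin> B" using up by (auto simp: B_def)
    show "C \<inter> D \<in> B" if CD: "C \<in> B" "D \<in> B" for C D
    proof -
      obtain V U where 1: "V \<in> G" "openin X U" "U \<notin> G" "V - U \<subseteq> C" "C \<subseteq> ?S"
        using CD(1) unfolding B_def by blast
      obtain W T where 2: "W \<in> G" "openin X T" "T \<notin> G" "W - T \<subseteq> D" "D \<subseteq> ?S"
        using CD(2) unfolding B_def by blast
      have "U \<union> T \<notin> G" using prime 1(2,3) 2(2,3) by blast
      then show ?thesis
        by (intro BI [of "V \<inter> W" "U \<union> T"]) (use 1 2 int in auto)
    qed
    show "D \<in> B" if "C \<in> B" "D \<in> Pow ?S" "C \<subseteq> D" for C D
      using that unfolding B_def by blast
  qed
  from ultrafilter_extension [OF this]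
  obtain F where F: "ultrafilter_on ?S F" "B \<subseteq> F" by blast
  have pfF: "proper_filter (Pow ?S) F" using F(1) by (simp add: ultrafilter_on_def)
  have "V \<in> F" if "V \<in> G" for V
    using BI [OF that openin_empty empty, of V] op [OF that] openin_subset F(2) by auto
  moreover have "U \<in> G" if "U \<in> F" "openin X U" for U
  proof (rule ccontr)
    assume "U \<notin> G"
    then have "?S - U \<in> F" using BI [OF top that(2)] F(2) by blast
    then have "U \<inter> (?S - U) \<in> F" using that(1) proper_filterD(2) [OF pfF] by blast
    then show False using proper_filter_empty [OF _ pfF] by simp
  qed
  ultimately have "open_trace X F = G" using op by (auto simp: open_trace_def)
  with F(1) show ?thesis by blast
qed

section \<open>The trace map between the two spaces\<close>

lemma openin_basic_prime_open_filter_space: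
  "openin X V \<Longrightarrow> openin (prime_open_filter_space X) {G. prime_open_filter X G \<and> V \<in> G}"
  unfolding openin_prime_open_filter_space
  by (rule union_of_inc) (auto simp: arbitrary_def)

lemma t0_space_prime_open_filter_space: "t0_space (prime_open_filter_space X)"
  unfolding t0_space_def topspace_prime_open_filter_space
proof (intro ballI impI)
  fix G H
  assume GH: "G \<in> {G. prime_open_filter X G}" "H \<in> {G. prime_open_filter X G}" "G \<noteq> H"
  then obtain V where V: "V \<in> G \<longleftrightarrow> V \<notin> H" by blast
  have "G \<subseteq> {U. openin X U}" "H \<subseteq> {U. openin X U}"
    using GH proper_filterD(1) by (auto simp: prime_open_filter_def)
  with V have "openin X V" by blast
  then show "\<exists>U. openin (prime_open_filter_space X) U \<and> (G \<notin> U) = (H \<in> U)"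
    using openin_basic_prime_open_filter_space [of X V] V GH
    by (intro exI [of _ "{G. prime_open_filter X G \<and> V \<in> G}"]) simp
qed

text \<open>
  The basic open sets of both spaces are indexed by the open sets of \<open>X\<close>, and the preimage
  of the one with index \<open>V\<close> is the one with index \<open>V\<close>. Preimages commute with unions, so
  the same index set \<open>\<V>\<close> describes \<open>U\<close> and \<open>W\<close>.
\<close>

lemma openin_ultrafilter_space_iff_open_trace:
  "openin (ultrafilter_space X) U \<longleftrightarrow>
     (\<exists>W. openin (prime_open_filter_space X) W \<and>
        U = {F \<in> topspace (ultrafilter_space X). open_trace X F \<in> W})"
    (is "_ \<longleftrightarrow> (\<exists>W. _ \<and> U = ?pre W)")
proof -
  let ?b = "\<lambda>V. {F. ultrafilter_on (topspace X) F \<and> V \<in> F}"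
  let ?c = "\<lambda>V. {G. prime_open_filter X G \<and> V \<in> G}"
  have pre: "?pre (\<Union>(?c ` \<V>)) = \<Union>(?b ` \<V>)" if "\<forall>V\<in>\<V>. openin X V" for \<V>
    using that prime_open_filter_open_trace [of X]
    by (auto simp: topspace_ultrafilter_space open_trace_def)
  have bas: "(arbitrary union_of (\<lambda>B. \<exists>V. openin X V \<and> B = f V)) U \<longleftrightarrow>
      (\<exists>\<V>. (\<forall>V\<in>\<V>. openin X V) \<and> U = \<Union>(f ` \<V>))"
    for f :: "'a set \<Rightarrow> 'a set set set" and U
  proof
    assume "(arbitrary union_of (\<lambda>B. \<exists>V. openin X V \<and> B = f V)) U"
    then obtain \<U> where \<U>: "\<forall>B\<in>\<U>. \<exists>V. openin X V \<and> B = f V" "U = \<Union>\<U>"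
      by (auto simp: union_of_def arbitrary_def)
    then have "\<U> = f ` {V. openin X V \<and> f V \<in> \<U>}" by auto
    with \<U>(2) have "U = \<Union>(f ` {V. openin X V \<and> f V \<in> \<U>})" by simp
    then show "\<exists>\<V>. (\<forall>V\<in>\<V>. openin X V) \<and> U = \<Union>(f ` \<V>)"
      by (intro exI [of _ "{V. openin X V \<and> f V \<in> \<U>}"]) simp
  next
    assume "\<exists>\<V>. (\<forall>V\<in>\<V>. openin X V) \<and> U = \<Union>(f ` \<V>)"
    then obtain \<V> where \<V>: "\<forall>V\<in>\<V>. openin X V" "U = \<Union>(f ` \<V>)" by blast
    show "(arbitrary union_of (\<lambda>B. \<exists>V. openin X V \<and> B = f V)) U"
      unfolding union_of_def arbitrary_def
      by (intro exI [of _ "f ` \<V>"]) (use \<V> in blast)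
  qed
  show ?thesis
    unfolding openin_ultrafilter_space openin_prime_open_filter_space bas
  proof
    assume "\<exists>\<V>. (\<forall>V\<in>\<V>. openin X V) \<and> U = \<Union>(?b ` \<V>)"
    then obtain \<V> where \<V>: "\<forall>V\<in>\<V>. openin X V" "U = \<Union>(?b ` \<V>)" by (elim exE conjE)
    show "\<exists>W. (\<exists>\<V>. (\<forall>V\<in>\<V>. openin X V) \<and> W = \<Union>(?c ` \<V>)) \<and> U = ?pre W"
      using \<V> pre [OF \<V>(1)]
      by (intro exI [of _ "\<Union>(?c ` \<V>)"] conjI exI [of _ \<V>]) (simp_all only:)
  next
    assume "\<exists>W. (\<exists>\<V>. (\<forall>V\<in>\<V>. openin X V) \<and> W = \<Union>(?c ` \<V>)) \<and> U = ?pre W"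
    then obtain \<V> W where \<V>: "\<forall>V\<in>\<V>. openin X V" "W = \<Union>(?c ` \<V>)" "U = ?pre W"
      by (elim exE conjE)
    have "U = \<Union>(?b ` \<V>)" using pre [OF \<V>(1)] unfolding \<V>(2,3) .
    with \<V>(1) show "\<exists>\<V>. (\<forall>V\<in>\<V>. openin X V) \<and> U = \<Union>(?b ` \<V>)"
      by (intro exI [of _ \<V>] conjI)
  qed
qed

lemma open_trace_image:
  "open_trace X ` topspace (ultrafilter_space X) = topspace (prime_open_filter_space X)"
  unfolding topspace_ultrafilter_space topspace_prime_open_filter_space
  using prime_open_filter_open_trace prime_open_filter_is_open_trace by blast

theorem proposition11:
  fixes X :: "'a topology"
    and R :: "'a set set topology \<Rightarrow> 'a set set topology"
    and r :: "'a set set topology \<Rightarrow> 'a set set \<Rightarrow> 'a set set"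
  assumes "T0_reflector R r"
  shows "\<exists>\<phi>. homeomorphic_map (R (ultrafilter_space X)) (prime_open_filter_space X) \<phi> \<and>
             (\<forall>F\<in>topspace (ultrafilter_space X).
                \<phi> (r (ultrafilter_space X) F) = open_trace X F)"
proof (rule T0_reflector_homeomorphic_map [OF assms t0_space_prime_open_filter_space])
  show "open_trace X ` topspace (ultrafilter_space X) = topspace (prime_open_filter_space X)"
    by (rule open_trace_image)
  then show "continuous_map (ultrafilter_space X) (prime_open_filter_space X) (open_trace X)"
    unfolding continuous_map_def openin_ultrafilter_space_iff_open_trace by blast
  show "\<exists>W. openin (prime_open_filter_space X) W \<and>
      U = {F \<in> topspace (ultrafilter_space X). open_trace X F \<in> W}"
    if "openin (ultrafilter_space X) U" for U
    using that by (simp only: openin_ultrafilter_space_iff_open_trace)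
qed

end
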